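(* Let $f\colon \{-1,1\}^n \to [-1,1]$ be a function of degree $d$. Then \[ \mathrm{Inf}[f] \leq \|\Delta(f)\|_\infty \leq d^2. \]
   Context: Every $f\colon\{-1,1\}^n\to\mathbb{R}$ has a unique representation as a multilinear polynomial $f=\sum_{S\subseteq[n]}\hat f(S)\prod_{i\in S}x_i$; its degree $\deg f$ is the degree of this polynomial. For $x\in\{-1,1\}^n$, $x\oplus e_i$ denotes $x$ with the $i$th coordinate flipped, and $f_i(x)=\frac{f(x)-f(x\oplus e_i)}{2}$. The (total $L_1$) influence is $\mathrm{Inf}[f]=\sum_{i=1}^n \mathbb{E}_x|f_i(x)|$, with $x$ uniform on $\{-1,1\}^n$. Define $\Delta(f)(x)=\sum_{i=1}^n|f_i(x)|$, so $\mathrm{Inf}[f]=\mathbb{E}[\Delta(f)]$, and $\|\Delta(f)\|_\infty=\max_{x\in\{-1,1\}^n}\Delta(f)(x)$. *)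

theory Defs
  imports "HOL-Probability.Probability"
begin

text \<open>The index set is \<open>[n] = {1..n}\<close>; points of the cube are functions on \<open>[n]\<close>, made
  unique by being \<open>undefined\<close> outside \<open>[n]\<close>.  A function on the cube is a HOL function of
  which only the values on \<open>cube n\<close> matter.\<close>

definition cube :: "nat \<Rightarrow> (nat \<Rightarrow> real) set"
  where "cube n = {1..n} \<rightarrow>\<^sub>E {-1, 1}"

definition multilinear_rep :: "nat \<Rightarrow> ((nat \<Rightarrow> real) \<Rightarrow> real) \<Rightarrow> (nat set \<Rightarrow> real) \<Rightarrow> bool"
  where "multilinear_rep n f c \<longleftrightarrow>
    (\<forall>x\<in>cube n. f x = (\<Sum>S\<in>Pow {1..n}. c S * (\<Prod>i\<in>S. x i))) \<and>
    (\<forall>S. \<not> S \<subseteq> {1..n} \<longrightarrow> c S = 0)"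

definition fourier_coeff :: "nat \<Rightarrow> ((nat \<Rightarrow> real) \<Rightarrow> real) \<Rightarrow> nat set \<Rightarrow> real"
  where "fourier_coeff n f = (THE c. multilinear_rep n f c)"

text \<open>As for the library's polynomials, the zero function has degree \<open>0\<close>.\<close>

definition cube_degree :: "nat \<Rightarrow> ((nat \<Rightarrow> real) \<Rightarrow> real) \<Rightarrow> nat"
  where "cube_degree n f = Max (insert 0 (card ` {S \<in> Pow {1..n}. fourier_coeff n f S \<noteq> 0}))"

definition flip :: "nat \<Rightarrow> (nat \<Rightarrow> real) \<Rightarrow> nat \<Rightarrow> real"
  where "flip i x = x(i := - x i)"

definition cube_deriv :: "nat \<Rightarrow> ((nat \<Rightarrow> real) \<Rightarrow> real) \<Rightarrow> (nat \<Rightarrow> real) \<Rightarrow> real"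
  where "cube_deriv i f x = (f x - f (flip i x)) / 2"

definition influence :: "nat \<Rightarrow> ((nat \<Rightarrow> real) \<Rightarrow> real) \<Rightarrow> real"
  where "influence n f =
    (\<Sum>i\<in>{1..n}. measure_pmf.expectation (pmf_of_set (cube n)) (\<lambda>x. \<bar>cube_deriv i f x\<bar>))"

definition Delta :: "nat \<Rightarrow> ((nat \<Rightarrow> real) \<Rightarrow> real) \<Rightarrow> (nat \<Rightarrow> real) \<Rightarrow> real"
  where "Delta n f x = (\<Sum>i\<in>{1..n}. \<bar>cube_deriv i f x\<bar>)"

definition Delta_sup_norm :: "nat \<Rightarrow> ((nat \<Rightarrow> real) \<Rightarrow> real) \<Rightarrow> real"
  where "Delta_sup_norm n f = Max (Delta n f ` cube n)"

lemma finite_cube: "finite (cube n)"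
  by (simp add: cube_def finite_PiE)

lemma cube_nonempty: "cube n \<noteq> {}"
  by (simp add: cube_def PiE_eq_empty_iff)

lemma cube_coord:
  assumes "x \<in> cube n" "i \<in> {1..n}"
  shows "x i = -1 \<or> x i = 1"
  using PiE_mem [OF assms(1) [unfolded cube_def] assms(2)] by simp

lemma flip_in_cube:
  assumes "x \<in> cube n" "i \<in> {1..n}"
  shows "flip i x \<in> cube n"
  using assms by (fastforce simp: cube_def flip_def PiE_iff extensional_def)

lemma influence_eq_expectation_Delta:
  "influence n f = measure_pmf.expectation (pmf_of_set (cube n)) (Delta n f)"
proof -
  have "(\<Sum>i\<in>{1..n}. \<Sum>x\<in>cube n. \<bar>cube_deriv i f x\<bar>) = (\<Sum>x\<in>cube n. Delta n f x)"
    unfolding Delta_def by (rule sum.swap)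
  then show ?thesis
    by (simp add: influence_def integral_pmf_of_set finite_cube cube_nonempty
        sum_divide_distrib [symmetric])
qed

text \<open>Existence and uniqueness of the multilinear representation, so that the definite
  description in \<^const>\<open>fourier_coeff\<close> is meaningful.\<close>

lemma sum_characters:
  assumes "x \<in> cube n" "y \<in> cube n"
  shows "(\<Sum>S\<in>Pow {1..n}. (\<Prod>i\<in>S. x i) * (\<Prod>i\<in>S. y i)) = (if x = y then 2 ^ n else 0)"
proof -
  have "(\<Sum>S\<in>Pow {1..n}. (\<Prod>i\<in>S. x i) * (\<Prod>i\<in>S. y i)) = (\<Prod>i\<in>{1..n}. x i * y i + 1)"
    by (subst prod_add) (simp_all add: prod.distrib)
  also have "\<dots> = (if x = y then 2 ^ n else 0)"
  proof (cases "x = y")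
    case True
    have "x i * x i + 1 = 2" if "i \<in> {1..n}" for i
      using cube_coord [OF assms(1) that] by auto
    then have "(\<Prod>i\<in>{1..n}. x i * x i + 1) = (\<Prod>i\<in>{1..n}. 2)"
      by (intro prod.cong) auto
    then show ?thesis using True by simp
  next
    case False
    then obtain i where i: "i \<in> {1..n}" "x i \<noteq> y i"
      using assms unfolding cube_def by (meson PiE_ext)
    then have "x i * y i + 1 = 0"
      using cube_coord [OF assms(1) i(1)] cube_coord [OF assms(2) i(1)] by auto
    then have "(\<Prod>i\<in>{1..n}. x i * y i + 1) = 0"
      using i(1) by (intro prod_zero) auto
    then show ?thesis using False by simp
  qed
  finally show ?thesis .
qed

lemma character_orthogonality:
  assumes "S \<subseteq> {1..n}" "T \<subseteq> {1..n}"
  shows "(\<Sum>x\<in>cube n. (\<Prod>i\<in>S. x i) * (\<Prod>i\<in>T. x i)) = (if S = T then 2 ^ n else 0)"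
proof -
  define g where "g i b = (if i \<in> S then b else 1) * (if i \<in> T then b else 1)" for i and b :: real
  have "(\<Prod>i\<in>S. x i) * (\<Prod>i\<in>T. x i) = (\<Prod>i\<in>{1..n}. g i (x i))" for x :: "nat \<Rightarrow> real"
    using assms by (simp add: g_def prod.distrib prod.inter_restrict [symmetric] Int_absorb1)
  then have "(\<Sum>x\<in>cube n. (\<Prod>i\<in>S. x i) * (\<Prod>i\<in>T. x i)) = (\<Sum>x\<in>cube n. \<Prod>i\<in>{1..n}. g i (x i))"
    by simp
  also have "\<dots> = (\<Prod>i\<in>{1..n}. \<Sum>b\<in>{-1, 1}. g i b)"
    unfolding cube_def by (rule prod_sum_PiE [symmetric]) auto
  also have "\<dots> = (\<Prod>i\<in>{1..n}. if i \<in> S \<longleftrightarrow> i \<in> T then 2 else 0)"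
    by (intro prod.cong) (auto simp: g_def)
  also have "\<dots> = (if S = T then 2 ^ n else 0)"
  proof (cases "S = T")
    case False
    then obtain i where "i \<in> {1..n}" "\<not> (i \<in> S \<longleftrightarrow> i \<in> T)"
      using assms by blast
    then show ?thesis using False by (auto intro!: prod_zero)
  qed simp
  finally show ?thesis .
qed

lemma multilinear_rep_exists: "\<exists>c. multilinear_rep n f c"
proof -
  define c where "c S = (if S \<subseteq> {1..n} then (\<Sum>x\<in>cube n. f x * (\<Prod>i\<in>S. x i)) / 2 ^ n else 0)" for S
  have "f y = (\<Sum>S\<in>Pow {1..n}. c S * (\<Prod>i\<in>S. y i))" if y: "y \<in> cube n" for y
  proof -
    have "(\<Sum>S\<in>Pow {1..n}. c S * (\<Prod>i\<in>S. y i)) =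
        (\<Sum>S\<in>Pow {1..n}. \<Sum>x\<in>cube n. f x * ((\<Prod>i\<in>S. x i) * (\<Prod>i\<in>S. y i)) / 2 ^ n)"
      by (intro sum.cong)
        (auto simp: c_def sum_distrib_right sum_divide_distrib mult.assoc)
    also have "\<dots> = (\<Sum>x\<in>cube n. f x * (\<Sum>S\<in>Pow {1..n}. (\<Prod>i\<in>S. x i) * (\<Prod>i\<in>S. y i)) / 2 ^ n)"
      by (subst sum.swap) (simp add: sum_distrib_left sum_divide_distrib)
    also have "\<dots> = (\<Sum>x\<in>cube n. if x = y then f x else 0)"
      using y by (intro sum.cong) (simp_all add: sum_characters del: One_nat_def)
    also have "\<dots> = f y"
      using y by (simp add: finite_cube)
    finally show ?thesis by simp
  qed
  then have "multilinear_rep n f c"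
    by (auto simp: multilinear_rep_def c_def)
  then show ?thesis by (rule exI [of _ c])
qed

lemma multilinear_rep_coeff:
  assumes "multilinear_rep n f c" "T \<subseteq> {1..n}"
  shows "c T = (\<Sum>x\<in>cube n. f x * (\<Prod>i\<in>T. x i)) / 2 ^ n"
proof -
  have "(\<Sum>x\<in>cube n. f x * (\<Prod>i\<in>T. x i)) =
      (\<Sum>x\<in>cube n. \<Sum>S\<in>Pow {1..n}. c S * ((\<Prod>i\<in>S. x i) * (\<Prod>i\<in>T. x i)))"
    using assms(1) by (intro sum.cong)
      (auto simp: multilinear_rep_def sum_distrib_right mult.assoc simp del: One_nat_def)
  also have "\<dots> = (\<Sum>S\<in>Pow {1..n}. c S * (\<Sum>x\<in>cube n. (\<Prod>i\<in>S. x i) * (\<Prod>i\<in>T. x i)))"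
    by (subst sum.swap) (simp add: sum_distrib_left)
  also have "\<dots> = (\<Sum>S\<in>Pow {1..n}. if S = T then c S * 2 ^ n else 0)"
    using assms(2) by (intro sum.cong) (simp_all add: character_orthogonality del: One_nat_def)
  also have "\<dots> = c T * 2 ^ n"
    using assms(2) by simp
  finally show ?thesis by simp
qed

lemma multilinear_rep_unique:
  assumes "multilinear_rep n f c" "multilinear_rep n f c'"
  shows "c = c'"
proof
  fix T
  show "c T = c' T"
  proof (cases "T \<subseteq> {1..n}")
    case True
    then show ?thesis
      using assms by (simp add: multilinear_rep_coeff del: One_nat_def)
  next
    case False
    then show ?thesis
      using assms by (simp add: multilinear_rep_def)
  qed
qed

lemma multilinear_rep_fourier_coeff: "multilinear_rep n f (fourier_coeff n f)"
  unfolding fourier_coeff_def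
proof (rule theI' [of "multilinear_rep n f"])
  obtain c where "multilinear_rep n f c"
    using multilinear_rep_exists [of n f] by (elim exE)
  then show "\<exists>!c. multilinear_rep n f c"
    by (intro ex1I [of _ c] multilinear_rep_unique)
qed

end

theory Submission
  imports Defs
begin

text \<open>Fix a vertex \<open>x\<close> and signs \<open>\<epsilon>\<^sub>i\<close>, and extend \<open>f\<close> multilinearly to \<open>[-1,1]\<^sup>n\<close>, where it is
  still bounded by \<open>1\<close>.  Along the curve \<open>y\<^sub>i(\<theta>) = x\<^sub>i cos (\<theta> + \<epsilon>\<^sub>i \<alpha>)\<close> the odd part of \<open>f\<close> is
  \<open>sin \<theta> U(cos \<theta>)\<close> with \<open>deg U < d\<close>, and \<open>U(1) = - sin \<alpha> h(cos \<alpha>)\<close> where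
  \<open>h(c) = \<Sum>\<^sub>i \<epsilon>\<^sub>i x\<^sub>i \<partial>\<^sub>i f(c x)\<close> also has degree less than \<open>d\<close>.  Schur's inequality (a polynomial \<open>p\<close>
  of degree less than \<open>d\<close> with \<open>\<bar>p(cos \<theta>) sin \<theta>\<bar> \<le> M\<close> satisfies \<open>\<bar>p(1)\<bar> \<le> d M\<close>), applied to \<open>U\<close>,
  gives \<open>\<bar>h(cos \<alpha>) sin \<alpha>\<bar> \<le> d\<close>; applied again, to \<open>h\<close>, it gives \<open>\<bar>h(1)\<bar> \<le> d\<^sup>2\<close>.  For suitable signs
  \<open>h(1)\<close> is \<open>\<Delta>(f)(x)\<close>.\<close>

section \<open>Chebyshev polynomials of the second kind and Schur's inequality\<close>

fun chebyshev_U :: "nat \<Rightarrow> real poly" where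
  "chebyshev_U 0 = 1"
| "chebyshev_U (Suc 0) = [:0, 2:]"
| "chebyshev_U (Suc (Suc k)) = [:0, 2:] * chebyshev_U (Suc k) - chebyshev_U k"

lemma degree_chebyshev_U_le: "degree (chebyshev_U k) \<le> k"
proof (induction k rule: chebyshev_U.induct)
  case (3 k)
  have "degree ([:0, 2:] * chebyshev_U (Suc k)) \<le> 1 + Suc k"
    using degree_mult_le [of "[:0, 2:]" "chebyshev_U (Suc k)"] 3(1) by simp
  then show ?case using 3(2) by (auto intro: degree_diff_le)
qed auto

lemma poly_chebyshev_U_1: "poly (chebyshev_U k) 1 = real (Suc k)"
  by (induction k rule: chebyshev_U.induct) auto

lemma poly_chebyshev_U_cos: "poly (chebyshev_U k) (cos t) * sin t = sin (real (Suc k) * t)"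
proof (induction k rule: chebyshev_U.induct)
  case 2
  then show ?case by (simp add: sin_double)
next
  case (3 k)
  define u where "u = real (Suc (Suc k)) * t"
  have "sin (u + t) = 2 * cos t * sin u - sin (u - t)"
    by (simp add: sin_add sin_diff)
  moreover have "u + t = real (Suc (Suc (Suc k))) * t" "u - t = real (Suc k) * t"
    by (simp_all add: u_def algebra_simps)
  ultimately show ?case using 3 by (simp add: algebra_simps u_def)
qed auto

text \<open>If the bound failed, a multiple of \<open>p\<close> agreeing with \<open>U\<^bsub>d-1\<^esub>\<close> at \<open>1\<close> would be so small at the
  \<open>d\<close> zeros of the Chebyshev polynomial \<open>T\<^sub>d\<close>, where \<open>U\<^bsub>d-1\<^esub>(cos \<theta>) sin \<theta>\<close> alternates between \<open>1\<close> and
  \<open>-1\<close>, that the difference would have \<open>d\<close> zeros.\<close>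

lemma schur_inequality_at_1:
  fixes p :: "real poly" and d :: nat
  assumes deg: "degree p < d"
    and bound: "\<And>t. 0 < t \<Longrightarrow> t < pi \<Longrightarrow> \<bar>poly p (cos t) * sin t\<bar> \<le> M"
  shows "\<bar>poly p 1\<bar> \<le> real d * M"
proof (rule ccontr)
  assume "\<not> ?thesis"
  then have gt: "real d * M < \<bar>poly p 1\<bar>" by simp
  have d: "d > 0" using deg by simp
  have "M \<ge> 0" using bound [of "pi / 2"] by simp
  then have p1: "poly p 1 \<noteq> 0" using gt d by (auto simp: mult_less_0_iff)
  define c where "c = real d / poly p 1"
  define g where "g = chebyshev_U (d - 1) - smult c p"
  define t where "t j = (2 * real j + 1) * pi / (2 * real d)" for j :: nat
  have t_pos: "0 < t j" for j
    using d by (simp add: t_def)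
  have t_less: "t j < pi" if "j < d" for j
  proof -
    have "(2 * real j + 1) * pi < 2 * real d * pi"
      using that by (intro mult_strict_right_mono) auto
    then show ?thesis using d by (simp add: t_def field_simps)
  qed
  have t_mono: "t i < t j" if "i < j" for i j
    using that d by (simp add: t_def divide_strict_right_mono)
  have cos_anti: "cos (t j) < cos (t i)" if "i < j" "j < d" for i j
    using t_mono [OF that(1)] t_pos [of i] t_less [OF that(2)]
    by (intro cos_monotone_0_pi) auto
  have sin_pos: "0 < sin (t j)" if "j < d" for j
    using t_pos t_less [OF that] by (rule sin_gt_zero)
  have sin_node: "sin (real d * t j) = (-1) ^ j" for j
  proof -
    have "real d * t j = real j * pi + pi / 2"
      using d by (simp add: t_def field_simps)
    then show ?thesis by (simp add: sin_add)
  qed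
  have sign: "0 < (-1) ^ j * poly g (cos (t j))" if j: "j < d" for j
  proof -
    have "\<bar>c * (poly p (cos (t j)) * sin (t j))\<bar> \<le> \<bar>c\<bar> * M"
      using bound [OF t_pos t_less [OF j]] by (simp add: abs_mult mult_left_mono)
    \<comment> \<open>The negated claim enters here: \<open>\<bar>c\<bar> * M\<close> is
      \<open>d * M / \<bar>poly p 1\<bar>\<close>.\<close>
    also have "\<dots> < 1"
      using gt p1 d by (simp add: c_def field_simps)
    finally have small: "\<bar>c * (poly p (cos (t j)) * sin (t j))\<bar> < 1" .
    have "poly g (cos (t j)) * sin (t j) = (-1) ^ j - c * (poly p (cos (t j)) * sin (t j))"
      using poly_chebyshev_U_cos [of "d - 1" "t j"] d
      by (simp add: g_def algebra_simps sin_node)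
    then have "0 < (-1) ^ j * (poly g (cos (t j)) * sin (t j))"
      using small by (cases "even j") auto
    then show ?thesis
      using sin_pos [OF j] by (simp add: mult.assoc [symmetric] zero_less_mult_iff)
  qed
  have "g \<noteq> 0" using sign [OF d] by auto
  have "\<exists>z. cos (t (Suc j)) < z \<and> z < cos (t j) \<and> poly g z = 0" if "Suc j < d" for j
  proof -
    have "poly g (cos (t (Suc j))) * poly g (cos (t j)) < 0"
      using sign [of j] sign [of "Suc j"] that
      by (cases "even j") (auto simp: mult_less_0_iff)
    then show ?thesis
      using poly_IVT [OF cos_anti [OF lessI that]] by blast
  qed
  then obtain z where z: "\<And>j. Suc j < d \<Longrightarrow>
      cos (t (Suc j)) < z j \<and> z j < cos (t j) \<and> poly g (z j) = 0"
    by metis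
  have z_anti: "z j < z i" if "i < j" "Suc j < d" for i j
  proof -
    have "cos (t j) \<le> cos (t (Suc i))"
      using that cos_anti [of "Suc i" j] by (cases "Suc i = j") auto
    then show ?thesis using z [of i] z [of j] that by auto
  qed
  have inj: "inj_on z {..<d - 1}"
  proof (rule linorder_inj_onI)
    fix i j assume "i < j" "j \<in> {..<d - 1}"
    then show "z i \<noteq> z j" using z_anti [of i j] by (simp add: less_diff_conv)
  qed auto
  have z_less: "z j < 1" if "j < d - 1" for j
    using z [of j] that cos_le_one [of "t j"] by linarith
  \<comment> \<open>The sign changes between the \<open>d\<close> nodes give only
    \<open>d - 1\<close> zeros. The missing one is \<open>1\<close>, by the choice of
    \<open>c\<close>; it is new because every \<open>z j\<close> lies below a cosine.\<close>
  have "poly g 1 = 0"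
    using d p1 by (simp add: g_def c_def poly_chebyshev_U_1)
  then have sub: "insert 1 (z ` {..<d - 1}) \<subseteq> {u. poly g u = 0}"
    using z by auto
  have "1 \<notin> z ` {..<d - 1}"
    using z_less by fastforce
  then have "card (insert 1 (z ` {..<d - 1})) = d"
    using inj d by (simp add: card_image)
  then have "d \<le> card {u. poly g u = 0}"
    using card_mono [OF poly_roots_finite [OF \<open>g \<noteq> 0\<close>] sub] by simp
  also have "\<dots> \<le> degree g"
    using \<open>g \<noteq> 0\<close> by (rule card_poly_roots_bound)
  also have "\<dots> \<le> d - 1"
    unfolding g_def using degree_chebyshev_U_le deg degree_smult_le [of c p]
    by (intro degree_diff_le) auto
  finally show False using d by simp
qed

section \<open>Multilinear extension to the solid cube\<close>

text \<open>The extension at \<open>y\<close> is the mean of \<open>f\<close> under independent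
  random signs with means \<open>y i\<close>; the weight \<open>w z\<close> is the probability of
  the vertex \<open>z\<close>.\<close>

lemma multilinear_extension_bounded:
  assumes rep: "multilinear_rep n f c"
    and f: "\<And>x. x \<in> cube n \<Longrightarrow> \<bar>f x\<bar> \<le> M"
    and y: "\<And>i. i \<in> {1..n} \<Longrightarrow> \<bar>y i\<bar> \<le> 1"
  shows "\<bar>\<Sum>S\<in>Pow {1..n}. c S * (\<Prod>i\<in>S. y i)\<bar> \<le> M"
proof -
  define w where "w z = (\<Prod>i\<in>{1..n}. (z i * y i + 1) / 2)" for z
  have w_nonneg: "0 \<le> w z" if "z \<in> cube n" for z
    unfolding w_def
  proof (intro prod_nonneg)
    fix i assume i: "i \<in> {1..n}"
    show "0 \<le> (z i * y i + 1) / 2"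
      using cube_coord [OF that i] y [OF i] by auto
  qed
  have "(\<Sum>z\<in>cube n. w z) = (\<Prod>i\<in>{1..n}. \<Sum>b\<in>{-1, 1}. (b * y i + 1) / 2)"
    unfolding cube_def w_def by (rule prod_sum_PiE [symmetric]) auto
  also have "\<dots> = 1"
    by (intro prod.neutral) (auto simp: field_simps)
  finally have w_sum: "(\<Sum>z\<in>cube n. w z) = 1" .
  have w_eq: "w z = (\<Sum>S\<in>Pow {1..n}. (\<Prod>i\<in>S. z i) * (\<Prod>i\<in>S. y i)) / 2 ^ n" for z
  proof -
    have "(\<Sum>S\<in>Pow {1..n}. (\<Prod>i\<in>S. z i) * (\<Prod>i\<in>S. y i)) = (\<Prod>i\<in>{1..n}. z i * y i + 1)"
      by (subst prod_add) (simp_all add: prod.distrib)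
    then show ?thesis by (simp add: w_def prod_dividef)
  qed
  have "(\<Sum>S\<in>Pow {1..n}. c S * (\<Prod>i\<in>S. y i)) =
      (\<Sum>S\<in>Pow {1..n}. \<Sum>z\<in>cube n. f z * ((\<Prod>i\<in>S. z i) * (\<Prod>i\<in>S. y i)) / 2 ^ n)"
    using multilinear_rep_coeff [OF rep]
    by (intro sum.cong) (auto simp: sum_distrib_right sum_divide_distrib mult.assoc)
  also have "\<dots> = (\<Sum>z\<in>cube n. f z * w z)"
    by (subst sum.swap) (simp add: w_eq sum_distrib_left sum_divide_distrib)
  finally have "\<bar>\<Sum>S\<in>Pow {1..n}. c S * (\<Prod>i\<in>S. y i)\<bar> \<le> (\<Sum>z\<in>cube n. \<bar>f z * w z\<bar>)"
    by simp
  also have "\<dots> \<le> (\<Sum>z\<in>cube n. M * w z)"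
    using f w_nonneg by (intro sum_mono) (auto simp: abs_mult mult_right_mono)
  also have "\<dots> = M"
    using w_sum by (simp add: sum_distrib_left [symmetric])
  finally show ?thesis .
qed

section \<open>Trigonometric curves and two uses of Schur's inequality\<close>

text \<open>Splits the product into its even and odd parts in \<open>t\<close>. The value of
  \<open>Q\<close> at \<open>1\<close> is the derivative of the product at \<open>t = 0\<close>. The
  alternative \<open>Q = 0\<close> covers the empty set, where no degree is below
  \<open>card S\<close>.\<close>

lemma prod_cos_sin_expansion:
  fixes a b :: real and e :: "'a \<Rightarrow> real"
  assumes "finite S"
  shows "\<exists>P Q. degree P \<le> card S \<and> (Q = 0 \<or> degree Q < card S) \<and> poly P 1 = a ^ card S \<and>
    poly Q 1 = - b * (\<Sum>i\<in>S. e i) * a ^ (card S - 1) \<and>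
    (\<forall>t. (\<Prod>i\<in>S. a * cos t - e i * b * sin t) = poly P (cos t) + sin t * poly Q (cos t))"
  using assms
proof (induction S rule: finite_induct)
  case empty
  show ?case by (intro exI [of _ 1] exI [of _ 0]) simp
next
  case (insert j S)
  then obtain P Q where PQ: "degree P \<le> card S" "Q = 0 \<or> degree Q < card S"
      "poly P 1 = a ^ card S" "poly Q 1 = - b * (\<Sum>i\<in>S. e i) * a ^ (card S - 1)"
      "\<And>t. (\<Prod>i\<in>S. a * cos t - e i * b * sin t) = poly P (cos t) + sin t * poly Q (cos t)"
    by blast
  \<comment> \<open>Multiply by the new factor and replace the square of the sine: the second
    multiplier is \<open>e j * b\<close> times \<open>1 - X^2\<close>, which vanishes at
    \<open>1\<close>.\<close>
  define P' where "P' = [:0, a:] * P - [:e j * b, 0, - (e j * b):] * Q"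
  define Q' where "Q' = [:0, a:] * Q - smult (e j * b) P"
  have "degree ([:0, a:] * P) \<le> Suc (card S)"
    using degree_mult_le [of "[:0, a:]" P] PQ(1) degree_pCons_le [of 0 "[:a:]"] by simp
  moreover have "degree ([:e j * b, 0, - (e j * b):] * Q) \<le> Suc (card S)"
  proof (cases "Q = 0")
    case False
    have "degree [:e j * b, 0, - (e j * b):] \<le> 2" by simp
    then show ?thesis
      using degree_mult_le [of "[:e j * b, 0, - (e j * b):]" Q] PQ(2) False by linarith
  qed simp
  ultimately have "degree P' \<le> Suc (card S)"
    unfolding P'_def by (rule degree_diff_le)
  moreover have "degree Q' \<le> card S"
    unfolding Q'_def
  proof (rule degree_diff_le)
    show "degree ([:0, a:] * Q) \<le> card S"
    proof (cases "Q = 0")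
      case False
      have "degree [:0, a:] \<le> 1" by simp
      then show ?thesis
        using degree_mult_le [of "[:0, a:]" Q] PQ(2) False by linarith
    qed simp
    show "degree (smult (e j * b) P) \<le> card S"
      using degree_smult_le [of "e j * b" P] PQ(1) by linarith
  qed
  moreover have "poly P' 1 = a ^ Suc (card S)"
    by (simp add: P'_def PQ(3))
  moreover have "poly Q' 1 = - b * (\<Sum>i\<in>insert j S. e i) * a ^ card S"
  \<comment> \<open>For empty \<open>S\<close> the exponent \<open>card S - 1\<close> is truncated
    to \<open>0\<close>, so raising it by one fails; but then \<open>poly Q 1 = 0\<close>.\<close>
  proof (cases "S = {}")
    case True
    then show ?thesis using PQ(3,4) by (simp add: Q'_def)
  next
    case False
    then have "a * a ^ (card S - 1) = a ^ card S"
      using insert.hyps(1) by (metis card_gt_0_iff power_eq_if less_numeral_extra(3))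
    then have "a * poly Q 1 = - b * (\<Sum>i\<in>S. e i) * a ^ card S"
      by (simp add: PQ(4) algebra_simps)
    then show ?thesis
      using insert.hyps by (simp add: Q'_def PQ(3) algebra_simps)
  qed
  moreover have "(\<Prod>i\<in>insert j S. a * cos t - e i * b * sin t) =
      poly P' (cos t) + sin t * poly Q' (cos t)" for t
  proof -
    have "(\<Prod>i\<in>insert j S. a * cos t - e i * b * sin t) =
        (a * cos t - e j * b * sin t) * (poly P (cos t) + sin t * poly Q (cos t))"
      using insert.hyps by (simp add: PQ(5))
    also have "\<dots> = a * cos t * poly P (cos t) - e j * b * (sin t)\<^sup>2 * poly Q (cos t)
        + sin t * poly Q' (cos t)"
      by (simp add: Q'_def algebra_simps power2_eq_square)
    also have "\<dots> = poly P' (cos t) + sin t * poly Q' (cos t)"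
      unfolding sin_squared_eq by (simp add: P'_def algebra_simps power2_eq_square)
    finally show ?thesis .
  qed
  ultimately show ?case
    using insert.hyps by (intro exI [of _ P'] exI [of _ Q']) auto
qed

text \<open>The sum is \<open>poly h 1\<close>, that is, the sum of the discrete derivatives of
  \<open>f\<close> at \<open>x\<close> with signs \<open>e i\<close>. Schur's inequality bounds
  \<open>U\<close> for each angle \<open>a\<close>, and this bound is the hypothesis for
  \<open>h\<close>.\<close>

lemma signed_character_sum_le:
  fixes c :: "nat set \<Rightarrow> real" and e x :: "nat \<Rightarrow> real"
  assumes rep: "multilinear_rep n f c"
    and f: "\<And>x. x \<in> cube n \<Longrightarrow> \<bar>f x\<bar> \<le> 1"
    and deg: "\<And>S. S \<subseteq> {1..n} \<Longrightarrow> c S \<noteq> 0 \<Longrightarrow> card S \<le> d"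
    and d: "d > 0"
    and x: "x \<in> cube n"
    and e: "\<And>i. e i = 1 \<or> e i = -1"
  shows "\<bar>\<Sum>S\<in>Pow {1..n}. c S * (\<Prod>i\<in>S. x i) * (\<Sum>i\<in>S. e i)\<bar> \<le> (real d)\<^sup>2"
proof -
  define u where "u S = c S * (\<Prod>i\<in>S. x i)" for S
  have u0: "u S = 0" if "S \<in> Pow {1..n}" "\<not> card S \<le> d" for S
    using deg [of S] that by (auto simp: u_def)
  \<comment> \<open>For empty \<open>S\<close> the truncated exponent is harmless, since the sum of
    the \<open>e i\<close> is \<open>0\<close>.\<close>
  define h where "h = (\<Sum>S\<in>Pow {1..n}. smult (u S * (\<Sum>i\<in>S. e i)) (monom 1 (card S - 1)))"
  have deg_h: "degree h < d"
  proof -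
    have "degree h \<le> d - 1"
      unfolding h_def
    proof (intro degree_sum_le)
      fix S assume S: "S \<in> Pow {1..n}"
      show "degree (smult (u S * (\<Sum>i\<in>S. e i)) (monom 1 (card S - 1))) \<le> d - 1"
        using u0 [OF S] by (cases "card S \<le> d") (auto simp: degree_monom_eq)
    qed simp
    then show ?thesis using d by simp
  qed
  have "\<bar>poly h (cos a) * sin a\<bar> \<le> real d" for a
  proof -
    \<comment> \<open>\<open>P\<close> stays under the quantifier: it contributes only to the even
      part, which cancels in \<open>F t - F (- t)\<close>.\<close>
    have "\<exists>Q. (Q = 0 \<or> degree Q < card S) \<and>
        poly Q 1 = - sin a * (\<Sum>i\<in>S. e i) * cos a ^ (card S - 1) \<and>
        (\<exists>P. \<forall>t. (\<Prod>i\<in>S. cos (t + e i * a)) = poly P (cos t) + sin t * poly Q (cos t))"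
      if "S \<in> Pow {1..n}" for S
    proof -
      have "cos (t + e i * a) = cos a * cos t - e i * sin a * sin t" for t i
        using e [of i] by (auto simp: cos_add cos_diff)
      moreover have "finite S" using that finite_subset by auto
      ultimately show ?thesis
        using prod_cos_sin_expansion [of S "cos a" "sin a" e] by simp blast
    qed
    then obtain Q where Q: "\<And>S. S \<in> Pow {1..n} \<Longrightarrow> Q S = 0 \<or> degree (Q S) < card S"
        "\<And>S. S \<in> Pow {1..n} \<Longrightarrow>
          poly (Q S) 1 = - sin a * (\<Sum>i\<in>S. e i) * cos a ^ (card S - 1)"
        "\<And>S. S \<in> Pow {1..n} \<Longrightarrow>
          \<exists>P. \<forall>t. (\<Prod>i\<in>S. cos (t + e i * a)) = poly P (cos t) + sin t * poly (Q S) (cos t)"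
      by metis
    define U where "U = (\<Sum>S\<in>Pow {1..n}. smult (u S) (Q S))"
    have "degree U \<le> d - 1"
      unfolding U_def
    proof (intro degree_sum_le)
      fix S assume S: "S \<in> Pow {1..n}"
      show "degree (smult (u S) (Q S)) \<le> d - 1"
        using u0 [OF S] Q(1) [OF S] by (cases "card S \<le> d") auto
    qed simp
    then have deg_U: "degree U < d" using d by simp
    define F where "F t = (\<Sum>S\<in>Pow {1..n}. c S * (\<Prod>i\<in>S. x i * cos (t + e i * a)))" for t
    have F_bound: "\<bar>F t\<bar> \<le> 1" for t
      unfolding F_def
    proof (rule multilinear_extension_bounded [OF rep f])
      fix i assume "i \<in> {1..n}"
      then have "\<bar>x i\<bar> = 1" using cube_coord [OF x] by fastforce
      then show "\<bar>x i * cos (t + e i * a)\<bar> \<le> 1" by (simp add: abs_mult)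
    qed
    have F_odd: "(F t - F (- t)) / 2 = poly U (cos t) * sin t" for t
    proof -
      have "F t - F (- t) = (\<Sum>S\<in>Pow {1..n}. 2 * (u S * (poly (Q S) (cos t) * sin t)))"
        unfolding F_def sum_subtractf [symmetric]
      proof (rule sum.cong [OF refl])
        fix S assume S: "S \<in> Pow {1..n}"
        obtain P where "\<And>t. (\<Prod>i\<in>S. cos (t + e i * a)) = poly P (cos t) + sin t * poly (Q S) (cos t)"
          using Q(3) [OF S] by blast
        then show "c S * (\<Prod>i\<in>S. x i * cos (t + e i * a)) - c S * (\<Prod>i\<in>S. x i * cos (- t + e i * a)) =
            2 * (u S * (poly (Q S) (cos t) * sin t))"
          by (simp only: prod.distrib) (simp add: u_def algebra_simps)
      qed
      then show ?thesis
        by (simp add: U_def poly_sum sum_distrib_left [symmetric] sum_distrib_right mult.assoc)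
    qed
    have "\<bar>poly U 1\<bar> \<le> real d * 1"
    proof (rule schur_inequality_at_1 [OF deg_U])
      show "\<bar>poly U (cos t) * sin t\<bar> \<le> 1" for t
        using F_bound [of t] F_bound [of "- t"] unfolding F_odd [symmetric] abs_le_iff by simp
    qed
    moreover have "poly U 1 = - (poly h (cos a) * sin a)"
      unfolding U_def h_def poly_sum sum_distrib_right sum_negf [symmetric]
      by (intro sum.cong refl) (simp only: poly_smult poly_monom Q(2), simp)
    ultimately show ?thesis by simp
  qed
  \<comment> \<open>Second use of Schur's inequality, now with \<open>M = d\<close>.\<close>
  then have "\<bar>poly h 1\<bar> \<le> real d * real d"
    by (intro schur_inequality_at_1 [OF deg_h])
  then show ?thesis
    by (simp add: h_def u_def poly_sum poly_monom power2_eq_square)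
qed

section \<open>Discrete derivatives and the final bounds\<close>

text \<open>Flipping coordinate \<open>i\<close> negates the characters with
  \<open>i \<in> S\<close> and fixes the others, which cancel.\<close>

lemma cube_deriv_eq_sum:
  assumes rep: "multilinear_rep n f c" and x: "x \<in> cube n" and i: "i \<in> {1..n}"
  shows "cube_deriv i f x = (\<Sum>S\<in>Pow {1..n}. if i \<in> S then c S * (\<Prod>j\<in>S. x j) else 0)"
proof -
  have flip: "(\<Prod>j\<in>S. flip i x j) = (if i \<in> S then - (\<Prod>j\<in>S. x j) else (\<Prod>j\<in>S. x j))"
    if "S \<in> Pow {1..n}" for S
  proof (cases "i \<in> S")
    case True
    have fin: "finite S" using that finite_subset by auto
    have "(\<Prod>j\<in>S - {i}. flip i x j) = (\<Prod>j\<in>S - {i}. x j)"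
      by (intro prod.cong) (auto simp: flip_def)
    then show ?thesis
      using True by (simp add: prod.remove [OF fin True]) (simp add: flip_def)
  next
    case False
    then have "(\<Prod>j\<in>S. flip i x j) = (\<Prod>j\<in>S. x j)"
      by (intro prod.cong) (auto simp: flip_def)
    then show ?thesis using False by simp
  qed
  have "f y = (\<Sum>S\<in>Pow {1..n}. c S * (\<Prod>j\<in>S. y j))" if "y \<in> cube n" for y
    using rep that by (simp add: multilinear_rep_def)
  then have "cube_deriv i f x =
      (\<Sum>S\<in>Pow {1..n}. (c S * (\<Prod>j\<in>S. x j) - c S * (\<Prod>j\<in>S. flip i x j)) / 2)"
    using x flip_in_cube [OF x i]
    by (simp add: cube_deriv_def sum_subtractf sum_divide_distrib [symmetric])
  also have "\<dots> = (\<Sum>S\<in>Pow {1..n}. if i \<in> S then c S * (\<Prod>j\<in>S. x j) else 0)"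
    by (intro sum.cong) (simp_all only: flip, auto)
  finally show ?thesis .
qed

text \<open>With \<open>e i\<close> the sign of the \<open>i\<close>th derivative at
  \<open>x\<close>, exchanging sums turns \<open>Delta n f x\<close> into the signed character
  sum.\<close>

lemma Delta_le_square:
  assumes rep: "multilinear_rep n f c"
    and f: "\<And>x. x \<in> cube n \<Longrightarrow> \<bar>f x\<bar> \<le> 1"
    and deg: "\<And>S. S \<subseteq> {1..n} \<Longrightarrow> c S \<noteq> 0 \<Longrightarrow> card S \<le> d"
    and x: "x \<in> cube n"
  shows "Delta n f x \<le> (real d)\<^sup>2"
proof -
  define e :: "nat \<Rightarrow> real" where "e i = (if cube_deriv i f x \<ge> 0 then 1 else -1)" for i
  have "Delta n f x = (\<Sum>i\<in>{1..n}. e i * cube_deriv i f x)"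
    unfolding Delta_def by (intro sum.cong) (auto simp: e_def)
  also have "\<dots> = (\<Sum>i\<in>{1..n}. \<Sum>S\<in>Pow {1..n}. if i \<in> S then c S * (\<Prod>j\<in>S. x j) * e i else 0)"
    by (intro sum.cong)
      (auto simp: cube_deriv_eq_sum [OF rep x] sum_distrib_left intro!: sum.cong)
  also have "\<dots> = (\<Sum>S\<in>Pow {1..n}. \<Sum>i\<in>{1..n}. if i \<in> S then c S * (\<Prod>j\<in>S. x j) * e i else 0)"
    by (rule sum.swap)
  also have "\<dots> = (\<Sum>S\<in>Pow {1..n}. c S * (\<Prod>i\<in>S. x i) * (\<Sum>i\<in>S. e i))"
  proof (rule sum.cong [OF refl])
    fix S assume "S \<in> Pow {1..n}"
    then have "{1..n} \<inter> S = S" by auto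
    then show "(\<Sum>i\<in>{1..n}. if i \<in> S then c S * (\<Prod>j\<in>S. x j) * e i else 0) =
        c S * (\<Prod>i\<in>S. x i) * (\<Sum>i\<in>S. e i)"
      using sum.inter_restrict [of "{1..n}" "\<lambda>i. c S * (\<Prod>j\<in>S. x j) * e i" S]
      by (simp add: sum_distrib_left)
  qed
  finally have eq: "Delta n f x = (\<Sum>S\<in>Pow {1..n}. c S * (\<Prod>i\<in>S. x i) * (\<Sum>i\<in>S. e i))" .
  show ?thesis
  \<comment> \<open>Schur's inequality needs a degree below \<open>d\<close>, so
    \<open>d = 0\<close> is separate: only the empty set can carry a coefficient, and its inner sum
    is \<open>0\<close>.\<close>
  proof (cases "d = 0")
    case True
    have "c S * (\<Prod>i\<in>S. x i) * (\<Sum>i\<in>S. e i) = 0" if "S \<in> Pow {1..n}" for S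
    proof (cases "c S = 0")
      case False
      have "finite S" using that finite_subset by auto
      then show ?thesis using deg [of S] False that True by auto
    qed simp
    then show ?thesis unfolding eq by (simp add: sum.neutral)
  next
    case False
    moreover have "e i = 1 \<or> e i = -1" for i
      by (simp add: e_def)
    ultimately show ?thesis
      using signed_character_sum_le [OF rep f deg _ x, of e] unfolding eq
      by (meson abs_le_D1 neq0_conv)
  qed
qed

lemma influence_le_Delta_sup_norm: "influence n f \<le> Delta_sup_norm n f"
proof -
  have "(\<Sum>x\<in>cube n. Delta n f x) \<le> real (card (cube n)) * Delta_sup_norm n f"
    unfolding Delta_sup_norm_def by (intro sum_bounded_above) (simp add: finite_cube)
  moreover have "card (cube n) > 0"
    by (simp add: card_gt_0_iff finite_cube cube_nonempty)
  ultimately show ?thesis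
    by (simp add: influence_eq_expectation_Delta integral_pmf_of_set finite_cube cube_nonempty
        field_simps)
qed

theorem theorem3p3:
  fixes n d :: nat and f :: "(nat \<Rightarrow> real) \<Rightarrow> real"
  assumes "\<And>x. x \<in> cube n \<Longrightarrow> f x \<in> {-1..1}"
    and "cube_degree n f = d"
  shows "influence n f \<le> Delta_sup_norm n f \<and> Delta_sup_norm n f \<le> (real d)\<^sup>2"
proof
  show "influence n f \<le> Delta_sup_norm n f"
    by (rule influence_le_Delta_sup_norm)
  have "card S \<le> d" if "S \<subseteq> {1..n}" "fourier_coeff n f S \<noteq> 0" for S
    unfolding assms(2) [symmetric] cube_degree_def using that by (intro Max_ge) auto
  moreover have "\<bar>f x\<bar> \<le> 1" if "x \<in> cube n" for x
    using assms(1) [OF that] by auto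
  ultimately have "Delta n f x \<le> (real d)\<^sup>2" if "x \<in> cube n" for x
    using Delta_le_square [OF multilinear_rep_fourier_coeff] that by blast
  then show "Delta_sup_norm n f \<le> (real d)\<^sup>2"
    unfolding Delta_sup_norm_def by (simp add: finite_cube cube_nonempty)
qed

end
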